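(* Let $\Gamma=\{1,\dots,9\}$, $A=\{i_\alpha\mid \alpha\in\Gamma,\ i\in\mathbb{Z}_{<0}\}$, and let $\mathcal{P}_{\mathcal{D}}$ be the set of colored partitions $\pi\in\mathcal{P}(A)$ satisfying the difference $\mathcal{D}$ condition, i.e. those containing no element of $\mathcal{D}$, where $\mathcal{P}(A)$, $\mathcal{D}$ and the degree $|\pi|$ are as defined in the context. Then, as formal power series in $q$, $$\sum_{n=0}^\infty \#\{\pi\in\mathcal{P}_{\mathcal{D}} : |\pi|=n\}\,q^n=\prod_{r=1}^\infty (1-q^r)^{-1}.$$
   Context: Colored partitions. Let $\Gamma=\{1,2,3,4,5,6,7,8,9\}$ (the set of colors) and $A=\Gamma\times\mathbb{Z}_{<0}$; write $i_\alpha$ for the pair $(\alpha,i)$, where $\alpha\in\Gamma$ and $i\in\mathbb{Z}_{<0}$. Let $\mathcal{P}(A)$ be the set of all maps $\pi:A\to\mathbb{N}=\{0,1,2,\dots\}$ with $\pi(a)=0$ for all but finitely many $a\in A$. Such a $\pi$ is called a (colored) partition and is also written as a commutative monomial $\pi=\prod_{a\in A}a^{\pi(a)}$; $\mathcal{P}(A)$ is a commutative monoid with product $(\pi\rho)(a)=\pi(a)+\rho(a)$, and its identity $1$ is the partition with no parts. In particular, for $a,b\in A$ the product $ab$ is the partition with parts $a$ and $b$ (if $a=b$, it is $a^2$, with $a$ of multiplicity $2$). For $\pi,\rho\in\mathcal{P}(A)$, one says that $\pi$ contains $\rho$ if $\pi(a)\ge\rho(a)$ for all $a\in A$. Degree.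 For integers $i>0$ define $|(-i)_\alpha|\in\mathbb{N}$ by $|(-i)_1|=3i-2$; $|(-i)_2|=|(-i)_3|=3i-1$; $|(-i)_4|=|(-i)_5|=|(-i)_6|=3i$; $|(-i)_7|=|(-i)_8|=3i+1$; $|(-i)_9|=3i+2$. For $\pi\in\mathcal{P}(A)$ the degree is $|\pi|=\sum_{a\in A}|a|\,\pi(a)$. Difference conditions. Let $E=(E_{\alpha\beta})_{\alpha,\beta\in\Gamma}$ be the matrix (row index $\alpha=1,\dots,9$, column index $\beta=1,\dots,9$) $$E=\begin{pmatrix} 2&2&2&1&2&2&2&2&2\\ 1&2&1&1&2&1&2&2&2\\ 1&1&2&1&1&2&2&2&2\\ 1&1&1&0&1&1&1&1&1\\ 0&0&1&1&0&1&1&2&2\\ 0&1&0&1&1&0&2&1&2\\ 0&1&0&1&1&0&2&1&2\\ 0&0&1&1&0&1&1&2&2\\ 0&0&0&1&0&0&1&1&2 \end{pmatrix}.$$ Define the subset $\mathcal{D}\subset\mathcal{P}(A)$ by $$\mathcal{D}=\{i_\alpha i_\beta\mid i\in\mathbb{Z}_{<0},\ \alpha,\beta\in\Gamma,\ E_{\alpha\beta}E_{\beta\alpha}\ge 1\}\cup\{(i-1)_\alpha i_\beta\mid i\in\mathbb{Z}_{<0},\ \alpha,\beta\in\Gamma,\ E_{\alpha\beta}=2\}$$ (the case $\alpha=\beta$ is allowed in both sets). A colored partition $\pi$ satisfies the difference $\mathcal{D}$ condition if $\pi$ contains no element of $\mathcal{D}$; equivalently, $\pi\in\mathcal{P}_{\mathcal{D}}:=\mathcal{P}(A)\setminus(\mathcal{P}(A)\mathcal{D})$,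 where $\mathcal{P}(A)\mathcal{D}=\{\pi\rho\mid\pi\in\mathcal{P}(A),\ \rho\in\mathcal{D}\}$. *)

theory Defs
  imports "HOL-Analysis.Analysis" "HOL-Library.Multiset"
begin

(* The pair (\<alpha>, i) is the part i_\<alpha> of colour \<alpha>. *)
definition colors :: "nat set" where
  "colors = {1..9}"

definition parts :: "(nat \<times> int) set" where
  "parts = colors \<times> {i. i < 0}"

(* Finitely supported maps A -> N are rendered as multisets over A: the value of the map
   at a is the multiplicity count \<pi> a, the monoid product is +, the identity is {#},
   and "\<pi> contains \<rho>" is \<rho> \<subseteq># \<pi>. *)
definition partitions :: "(nat \<times> int) multiset set" where
  "partitions = {\<pi>. set_mset \<pi> \<subseteq> parts}"

(* The colour is the first component; m is the i > 0 of (-i)_\<alpha>, so that the natural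
   number subtractions below do not truncate on parts. *)
definition part_degree :: "nat \<times> int \<Rightarrow> nat" where
  "part_degree a =
    (let \<alpha> = fst a; m = nat (- snd a) in
      if \<alpha> = 1 then 3 * m - 2
      else if \<alpha> \<in> {2, 3} then 3 * m - 1
      else if \<alpha> \<in> {4, 5, 6} then 3 * m
      else if \<alpha> \<in> {7, 8} then 3 * m + 1
      else 3 * m + 2)"

definition partition_degree :: "(nat \<times> int) multiset \<Rightarrow> nat" where
  "partition_degree \<pi> = (\<Sum>a\<in>#\<pi>. part_degree a)"

definition E_rows :: "nat list list" where
  "E_rows =
    [[2, 2, 2, 1, 2, 2, 2, 2, 2],
     [1, 2, 1, 1, 2, 1, 2, 2, 2],
     [1, 1, 2, 1, 1, 2, 2, 2, 2],
     [1, 1, 1, 0, 1, 1, 1, 1, 1],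
     [0, 0, 1, 1, 0, 1, 1, 2, 2],
     [0, 1, 0, 1, 1, 0, 2, 1, 2],
     [0, 1, 0, 1, 1, 0, 2, 1, 2],
     [0, 0, 1, 1, 0, 1, 1, 2, 2],
     [0, 0, 0, 1, 0, 0, 1, 1, 2]]"

definition E :: "nat \<Rightarrow> nat \<Rightarrow> nat" where
  "E \<alpha> \<beta> = E_rows ! (\<alpha> - 1) ! (\<beta> - 1)"

definition D :: "(nat \<times> int) multiset set" where
  "D = {{#(\<alpha>, i), (\<beta>, i)#} | \<alpha> \<beta> i.
          \<alpha> \<in> colors \<and> \<beta> \<in> colors \<and> i < 0 \<and> E \<alpha> \<beta> * E \<beta> \<alpha> \<ge> 1}
     \<union> {{#(\<alpha>, i - 1), (\<beta>, i)#} | \<alpha> \<beta> i.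
          \<alpha> \<in> colors \<and> \<beta> \<in> colors \<and> i < 0 \<and> E \<alpha> \<beta> = 2}"

definition P_D :: "(nat \<times> int) multiset set" where
  "P_D = {\<pi> \<in> partitions. \<not> (\<exists>\<rho>\<in>D. \<rho> \<subseteq># \<pi>)}"

lemma P_D_eq: "P_D = partitions - {\<pi> + \<rho> | \<pi> \<rho>. \<pi> \<in> partitions \<and> \<rho> \<in> D}"
proof -
  have "(\<exists>\<rho>\<in>D. \<rho> \<subseteq># \<pi>) \<longleftrightarrow> (\<exists>\<sigma> \<rho>. \<pi> = \<sigma> + \<rho> \<and> \<sigma> \<in> partitions \<and> \<rho> \<in> D)"
    if "\<pi> \<in> partitions" for \<pi>
  proof
    assume "\<exists>\<rho>\<in>D. \<rho> \<subseteq># \<pi>"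
    then obtain \<rho> where \<rho>: "\<rho> \<in> D" "\<rho> \<subseteq># \<pi>" by blast
    have "\<pi> = (\<pi> - \<rho>) + \<rho>" using \<rho> by simp
    moreover have "\<pi> - \<rho> \<in> partitions"
      using that by (auto simp: partitions_def dest: in_diffD)
    ultimately show "\<exists>\<sigma> \<rho>. \<pi> = \<sigma> + \<rho> \<and> \<sigma> \<in> partitions \<and> \<rho> \<in> D"
      using \<rho> by blast
  qed (metis mset_subset_eq_add_right)
  then show ?thesis unfolding P_D_def by blast
qed

(* The cardinalities in the generating function are those of finite sets. *)
lemma finite_P_D_degree: "finite {\<pi> \<in> P_D. partition_degree \<pi> = n}"
proof -
  let ?B = "{1..9::nat} \<times> {- int n - 1..0}"
  have part: "nat (- snd a) \<le> part_degree a \<and> part_degree a \<ge> 1" if "a \<in> parts" for a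
    using that by (auto simp: parts_def part_degree_def Let_def)
  have "set_mset \<pi> \<subseteq> ?B \<and> size \<pi> \<le> n" if "\<pi> \<in> P_D" "partition_degree \<pi> = n" for \<pi>
  proof
    have sub: "set_mset \<pi> \<subseteq> parts" using that by (auto simp: P_D_def partitions_def)
    show "set_mset \<pi> \<subseteq> ?B"
    proof
      fix a assume a: "a \<in># \<pi>"
      then obtain \<sigma> where "\<pi> = add_mset a \<sigma>" by (metis insert_DiffM)
      then have "part_degree a \<le> n" using that by (auto simp: partition_degree_def)
      with part[of a] a sub have "nat (- snd a) \<le> n" "a \<in> parts" by force+
      then show "a \<in> ?B" by (auto simp: parts_def colors_def)
    qed
    have "size \<pi> = (\<Sum>a\<in>#\<pi>. 1)" by simp
    also have "\<dots> \<le> (\<Sum>a\<in>#\<pi>. part_degree a)"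
      by (rule sum_mset_mono) (use part sub in blast)
    finally show "size \<pi> \<le> n" using that by (simp add: partition_degree_def)
  qed
  then have sub: "{\<pi> \<in> P_D. partition_degree \<pi> = n} \<subseteq> (\<Union>k\<le>n. {\<pi>. set_mset \<pi> \<subseteq> ?B \<and> size \<pi> = k})"
    by auto
  have "finite {\<pi>. set_mset \<pi> \<subseteq> ?B \<and> size \<pi> = k}" for k
    using finite_multisets_of_size[of ?B k] by (simp add: multisets_of_size_def)
  then have "finite (\<Union>k\<le>n. {\<pi>. set_mset \<pi> \<subseteq> ?B \<and> size \<pi> = k})"
    by blast
  with sub show ?thesis by (rule finite_subset)
qed

end

theory Submission
  imports Defs
begin

text \<open>
  List the parts of a partition by increasing \<open>i\<close> for \<open>(-i)\<^sub>\<alpha>\<close>, and by increasing colour for equal \<open>i\<close>.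
  Since \<open>E\<close> satisfies the triangle inequality and \<open>E \<alpha> \<beta> = 0\<close> forces \<open>\<beta> \<le> \<alpha>\<close>, the difference condition
  says exactly that the level \<open>i\<close> grows by at least \<open>E \<beta> \<alpha>\<close> from a part of colour \<open>\<alpha>\<close> to the next one,
  of colour \<open>\<beta>\<close>.

  Let \<open>G\<^sub>L(b)\<close> be the generating function of such lists of length \<open>L\<close> that may follow a part of
  colour \<open>b\<close> and level 0. A part of colour 4 and level 0 has degree 0 and can be prepended freely, so
  \<open>G\<^sub>L(4)\<close> counts the partitions with at most \<open>L\<close> parts. Removing the first part \<open>c\<close> and lowering all
  levels gives, with \<open>w(c) = |(-i)\<^sub>c| - 3i\<close>,
  \<open>(1 - q\<^bsup>3(L+1)\<^esup>) G\<^sub>L\<^sub>+\<^sub>1(b) = (\<Sum>c. q\<^bsup>3(L+1)E(c,b) + w(c)\<^esup> G\<^sub>L(c))\<close>.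
  This system is solved by
  \<open>A\<^sub>L = (\<Sum>s. (\<Prod>i<s. 1 - q\<^bsup>3(L-i)\<^esup>) q\<^bsup>s(s-1)\<^esup> / (q;q)\<^sub>s\<^sup>2)\<close> for \<open>b = 1\<close>, the same sum \<open>B\<^sub>L\<close> with
  \<open>q\<^bsup>s*s\<^esup>\<close> for \<open>b = 2,\<dots>,6\<close>, \<open>q\<^bsup>3L\<^esup> A\<^sub>L\<close> for \<open>b = 7, 8\<close> and \<open>q\<^bsup>3L\<^esup> B\<^sub>L\<close> for \<open>b = 9\<close>; the
  identities needed for this telescope. As \<open>L\<close> grows, \<open>G\<^sub>L(4) = B\<^sub>L\<close> tends to Durfee's sum
  \<open>(\<Sum>s. q\<^bsup>s*s\<^esup> / (q;q)\<^sub>s\<^sup>2)\<close>, which is the Euler product.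
\<close>

section \<open>Durfee sums\<close>

definition inv_qpoch :: "nat \<Rightarrow> 'a::field fps" where
  "inv_qpoch s = (\<Prod>i<s. inverse (1 - fps_X ^ Suc i))"

text \<open>The truncated subtraction makes a factor vanish as soon as \<open>s > L\<close>.\<close>

definition falling :: "nat \<Rightarrow> nat \<Rightarrow> nat \<Rightarrow> 'a::field fps" where
  "falling k L s = (\<Prod>i<s. 1 - fps_X ^ (k * (L - i)))"

lemma falling_0 [simp]: "falling k L 0 = 1"
  by (simp add: falling_def)

lemma falling_eq_0: "L < s \<Longrightarrow> falling k L s = 0"
  unfolding falling_def by (rule prod_zero) (auto intro!: bexI[of _ L])

lemma falling_Suc_left: "falling k (Suc L) (Suc s) = (1 - fps_X ^ (k * Suc L)) * falling k L s"
  unfolding falling_def by (subst prod.lessThan_Suc_shift) simp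

text \<open>Multiplying the last factor by \<open>q^(k*s)\<close> separates the dependence on
  \<open>s\<close> from that on \<open>L\<close>; for \<open>s > L\<close> both sides
  vanish.\<close>

lemma falling_Suc_right:
  "fps_X ^ (k * s) * falling k L (Suc s) = (fps_X ^ (k * s) - fps_X ^ (k * L)) * falling k L s"
proof (cases "s \<le> L")
  case True
  then have "k * L = k * s + k * (L - s)" by (simp add: algebra_simps)
  then have "(fps_X :: 'a fps) ^ (k * L) = fps_X ^ (k * s) * fps_X ^ (k * (L - s))"
    by (simp add: power_add)
  then show ?thesis by (simp add: falling_def algebra_simps)
qed (simp add: falling_eq_0)

lemma inv_qpoch_0 [simp]: "inv_qpoch 0 = 1"
  by (simp add: inv_qpoch_def)

lemma one_minus_X_power_neq_0: "1 - fps_X ^ Suc n \<noteq> (0 :: 'a::field fps)"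
proof
  assume "1 - fps_X ^ Suc n = (0 :: 'a fps)"
  then have "fps_nth (1 - fps_X ^ Suc n :: 'a fps) 0 = 0" by simp
  then show False by simp
qed

lemma inv_qpoch_Suc: "inv_qpoch (Suc s) * (1 - fps_X ^ Suc s) = (inv_qpoch s :: 'a::field fps)"
proof -
  have "inverse (1 - fps_X ^ Suc s) * (1 - fps_X ^ Suc s) = (1 :: 'a fps)"
    by (rule inverse_mult_eq_1) simp
  then show ?thesis
    by (simp add: inv_qpoch_def mult.assoc)
qed

lemma power_Suc_sq: "(x::'a::monoid_mult) ^ (Suc n)\<^sup>2 = x ^ (n\<^sup>2 - n) * x ^ (3 * n) * x"
proof -
  have "n \<le> n\<^sup>2" by (simp add: power2_nat_le_imp_le power2_eq_square)
  then have "(Suc n)\<^sup>2 = (n\<^sup>2 - n) + 3 * n + 1" by (simp add: power2_eq_square)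
  then show ?thesis by (metis power_add power_one_right)
qed

lemma power_sq: "(x::'a::monoid_mult) ^ n\<^sup>2 = x ^ (n\<^sup>2 - n) * x ^ n"
proof -
  have "n \<le> n\<^sup>2" by (simp add: power2_eq_square)
  then show ?thesis by (simp flip: power_add)
qed

text \<open>
  In the next three lemmas \<open>p = q\<^bsup>n\<^esup>\<close>, \<open>w = q\<^bsup>n*n-n\<^esup>\<close>, \<open>e = w p\<close>, \<open>u = 1 / (q;q)\<^sub>n\<^sub>+\<^sub>1\<close>, and the primed
  letter is the next value of \<open>falling\<close>. The hypothesis, \<open>falling_Suc_right\<close>, eliminates the factor
  \<open>\<zeta> = q\<^bsup>3L\<^esup>\<close> (or \<open>y = q\<^bsup>N\<^esup>\<close>), which is what makes the sums over \<open>s\<close> telescope.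
\<close>

lemma telescope_step_diff:
  fixes q p \<zeta> w u R R' :: "'a::idom"
  assumes "p ^ 3 * R' = (p ^ 3 - \<zeta>) * R"
  shows "R' * (w * p ^ 3 * q) * (1 - q * p) * u\<^sup>2 =
    R * (w * p) * (1 - p) * (u * (1 - q * p))\<^sup>2
    + ((1 - q ^ 3 * \<zeta>) * R * (w * p\<^sup>2 * (u * (1 - q * p)) * u)
    - R * (q * \<zeta> * (w * (u * (1 - q * p))\<^sup>2) + (1 + q\<^sup>2 * \<zeta>) * (w * p * (u * (1 - q * p))\<^sup>2)))"
proof -
  have "R' * (w * p ^ 3 * q) * (1 - q * p) * u\<^sup>2 = (p ^ 3 * R') * w * q * (1 - q * p) * u\<^sup>2"
    by (simp add: algebra_simps)
  then show ?thesis unfolding assms by algebra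
qed

lemma telescope_step_rec:
  fixes q p \<zeta> w u R R' :: "'a::idom"
  assumes "p ^ 3 * R' = (p ^ 3 - \<zeta>) * R"
  shows "R' * (w * p ^ 3 * q * (q * p)) * u\<^sup>2 =
    R * (w * p * p) * (u * (1 - q * p))\<^sup>2
    + ((1 - q ^ 3 * \<zeta>) * R * (w * p ^ 3 * q * u\<^sup>2)
    - q\<^sup>2 * \<zeta> * R * (w * p * (u * (1 - q * p))\<^sup>2)
    - (1 + 2 * q ^ 3 * \<zeta>) * R * (w * p\<^sup>2 * (u * (1 - q * p)) * u))"
proof -
  have "R' * (w * p ^ 3 * q * (q * p)) * u\<^sup>2 = (p ^ 3 * R') * w * q * (q * p) * u\<^sup>2"
    by (simp add: algebra_simps)
  then show ?thesis unfolding assms by algebra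
qed

lemma telescope_step_durfee:
  fixes q p y u r r' e :: "'a::idom"
  assumes "p * r' = (p - y) * r"
  shows "r' * (e * p\<^sup>2 * q * u\<^sup>2) * (1 - q\<^sup>2 * p * y) = r * (e * (u * (1 - q * p))\<^sup>2) * (1 - q * p * y)
    + ((1 - q * y)\<^sup>2 * r * (e * p\<^sup>2 * q * u\<^sup>2) - r * (e * (u * (1 - q * p))\<^sup>2))"
proof -
  have "r' * (e * p\<^sup>2 * q * u\<^sup>2) * (1 - q\<^sup>2 * p * y) = (p * r') * e * p * q * u\<^sup>2 * (1 - q\<^sup>2 * p * y)"
    by (simp add: algebra_simps power2_eq_square)
  then show ?thesis unfolding assms by algebra
qed


section \<open>Recurrences for finite Durfee sums\<close>

text \<open>For \<open>k = 3\<close>, \<open>c = 1\<close> and \<open>c = 0\<close> give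
  \<open>A\<^sub>L\<close> and \<open>B\<^sub>L\<close>; \<open>k = 1\<close>, \<open>c = 0\<close>
  is the classical finite Durfee sum, needed for the limit.\<close>

definition durfee_sum :: "nat \<Rightarrow> nat \<Rightarrow> nat \<Rightarrow> 'a::field fps" where
  "durfee_sum k c L = (\<Sum>s\<le>L. falling k L s * fps_X ^ (s\<^sup>2 - c * s) * (inv_qpoch s)\<^sup>2)"

lemma durfee_sum_0 [simp]: "durfee_sum k c 0 = 1"
  by (simp add: durfee_sum_def)

text \<open>Isolating \<open>s = 0\<close> and applying \<open>falling_Suc_left\<close> leaves
  \<open>falling k L\<close>, so that sums for \<open>L + 1\<close> and \<open>L\<close> can be
  compared termwise.\<close>

lemma durfee_sum_Suc:
  "durfee_sum k c (Suc L) = (1 + (1 - fps_X ^ (k * Suc L)) *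
    (\<Sum>s\<le>L. falling k L s * fps_X ^ ((Suc s)\<^sup>2 - c * Suc s) * (inv_qpoch (Suc s))\<^sup>2) :: 'a::field fps)"
proof -
  have "durfee_sum k c (Suc L) = (1 + (\<Sum>s\<le>L. falling k (Suc L) (Suc s) *
      fps_X ^ ((Suc s)\<^sup>2 - c * Suc s) * (inv_qpoch (Suc s))\<^sup>2) :: 'a fps)"
    unfolding durfee_sum_def sum.atMost_Suc_shift by simp
  then show ?thesis by (simp only: falling_Suc_left sum_distrib_left mult.assoc)
qed

text \<open>Arises from \<open>q^(s^2+s) - q^((s+1)^2) = q^(s^2+s) * (1 - q^(s+1))\<close>, whose
  last factor turns one \<open>inv_qpoch (Suc s)\<close> into \<open>inv_qpoch s\<close>.\<close>

abbreviation (input) mixed_term :: "nat \<Rightarrow> 'a::field fps" where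
  "mixed_term s \<equiv> fps_X ^ (s\<^sup>2 + s) * inv_qpoch s * inv_qpoch (Suc s)"

lemma power_3_mult: "(x::'a::monoid_mult) ^ (3 * n) = (x ^ n) ^ 3"
  by (simp add: mult.commute flip: power_mult)

text \<open>The right-hand side is a discrete antiderivative of the summand; at
  \<open>n = L + 1\<close> it vanishes because \<open>falling\<close> does, which yields
  \<open>durfee_sum_rec_diff\<close>.\<close>

lemma telescope_diff:
  "(\<Sum>s<n. (1 - fps_X ^ (3 * Suc L)) * falling 3 L s * mixed_term s
      - falling 3 L s * (fps_X * fps_X ^ (3 * L) * (fps_X ^ (s\<^sup>2 - s) * (inv_qpoch s)\<^sup>2)
         + (1 + fps_X\<^sup>2 * fps_X ^ (3 * L)) * (fps_X ^ s\<^sup>2 * (inv_qpoch s)\<^sup>2)))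
   = (falling 3 L n * fps_X ^ n\<^sup>2 * (1 - fps_X ^ n) * (inv_qpoch n)\<^sup>2 :: 'a::field fps)"
proof (induction n)
  case (Suc n)
  \<comment> \<open>Naming the powers of \<open>fps_X\<close> turns the induction step into the
    polynomial identity \<open>telescope_step_diff\<close>.\<close>
  define q p \<zeta> w u where "q = (fps_X :: 'a fps)" and "p = q ^ n" and "\<zeta> = q ^ (3 * L)"
    and "w = q ^ (n\<^sup>2 - n)" and "u = (inv_qpoch (Suc n) :: 'a fps)"
  have i: "inv_qpoch n = u * (1 - q * p)"
    using inv_qpoch_Suc[of n, where 'a='a] by (simp add: u_def q_def p_def)
  have "p ^ 3 * falling 3 L (Suc n) = (p ^ 3 - \<zeta>) * falling 3 L n"
    using falling_Suc_right[of 3 n L, where 'a='a] by (simp only: p_def q_def \<zeta>_def power_3_mult)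
  note step = telescope_step_diff[OF this, of w q u]
  have sq: "q ^ (Suc n)\<^sup>2 = w * p ^ 3 * q" "q ^ n\<^sup>2 = w * p"
    unfolding w_def p_def by (simp only: power_Suc_sq power_3_mult, simp only: power_sq)
  have "q ^ (3 * Suc L) = q ^ 3 * \<zeta>"
    by (simp only: \<zeta>_def mult_Suc_right power_add)
  then have pw: "q ^ (Suc n)\<^sup>2 = w * p ^ 3 * q" "q ^ n\<^sup>2 = w * p" "q ^ (n\<^sup>2 + n) = w * p\<^sup>2"
    "q ^ Suc n = q * p" "q ^ (3 * Suc L) = q ^ 3 * \<zeta>"
    using sq by (simp_all only: power_add power_Suc p_def[symmetric] power2_eq_square mult.assoc)
  show ?case
    unfolding sum.lessThan_Suc Suc.IH
    unfolding q_def[symmetric] pw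
    unfolding i u_def[symmetric] p_def[symmetric] w_def[symmetric] \<zeta>_def[symmetric]
    using step by (simp only: mult_ac)
qed simp

lemma telescope_rec:
  "1 + (\<Sum>s<n. (1 - fps_X ^ (3 * Suc L)) * falling 3 L s * (fps_X ^ (Suc s)\<^sup>2 * (inv_qpoch (Suc s))\<^sup>2)
      - fps_X\<^sup>2 * fps_X ^ (3 * L) * falling 3 L s * (fps_X ^ s\<^sup>2 * (inv_qpoch s)\<^sup>2)
      - (1 + 2 * fps_X ^ (3 * Suc L)) * falling 3 L s * mixed_term s)
   = (falling 3 L n * fps_X ^ (n\<^sup>2 + n) * (inv_qpoch n)\<^sup>2 :: 'a::field fps)"
proof (induction n)
  case (Suc n)
  define q p \<zeta> w u where "q = (fps_X :: 'a fps)" and "p = q ^ n" and "\<zeta> = q ^ (3 * L)"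
    and "w = q ^ (n\<^sup>2 - n)" and "u = (inv_qpoch (Suc n) :: 'a fps)"
  have i: "inv_qpoch n = u * (1 - q * p)"
    using inv_qpoch_Suc[of n, where 'a='a] by (simp add: u_def q_def p_def)
  have "p ^ 3 * falling 3 L (Suc n) = (p ^ 3 - \<zeta>) * falling 3 L n"
    using falling_Suc_right[of 3 n L, where 'a='a] by (simp only: p_def q_def \<zeta>_def power_3_mult)
  note step = telescope_step_rec[OF this, of w q u]
  have sq: "q ^ (Suc n)\<^sup>2 = w * p ^ 3 * q" "q ^ n\<^sup>2 = w * p"
    unfolding w_def p_def by (simp only: power_Suc_sq power_3_mult, simp only: power_sq)
  have "q ^ (3 * Suc L) = q ^ 3 * \<zeta>"
    by (simp only: \<zeta>_def mult_Suc_right power_add)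
  then have pw: "q ^ ((Suc n)\<^sup>2 + Suc n) = w * p ^ 3 * q * (q * p)" "q ^ (Suc n)\<^sup>2 = w * p ^ 3 * q"
    "q ^ n\<^sup>2 = w * p" "q ^ (n\<^sup>2 + n) = w * p * p" "q ^ (3 * Suc L) = q ^ 3 * \<zeta>"
    using sq by (simp_all only: power_add power_Suc p_def[symmetric])
  show ?case
    unfolding sum.lessThan_Suc add.assoc[symmetric] Suc.IH
    unfolding q_def[symmetric] pw
    unfolding i u_def[symmetric] p_def[symmetric] w_def[symmetric] \<zeta>_def[symmetric]
    using step by (simp only: mult_ac power2_eq_square)
qed simp

text \<open>At \<open>n = N + 1\<close> both sides are zero, and this says
  \<open>(1 - q^(N+1)) * durfee_sum 1 0 (N+1) = durfee_sum 1 0 N\<close>.\<close>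

lemma telescope_durfee:
  "(1 - fps_X ^ Suc N) + (\<Sum>s<n. (1 - fps_X ^ Suc N)\<^sup>2 * falling 1 N s * (fps_X ^ (Suc s)\<^sup>2 * (inv_qpoch (Suc s))\<^sup>2)
      - falling 1 N s * (fps_X ^ s\<^sup>2 * (inv_qpoch s)\<^sup>2))
   = (falling 1 N n * (fps_X ^ n\<^sup>2 * (inv_qpoch n)\<^sup>2) * (1 - fps_X ^ Suc n * fps_X ^ N) :: 'a::field fps)"
proof (induction n)
  case (Suc n)
  define q p y e u where "q = (fps_X :: 'a fps)" and "p = q ^ n" and "y = q ^ N"
    and "e = q ^ n\<^sup>2" and "u = (inv_qpoch (Suc n) :: 'a fps)"
  have i: "inv_qpoch n = u * (1 - q * p)"
    using inv_qpoch_Suc[of n, where 'a='a] by (simp add: u_def q_def p_def)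
  have "p * falling 1 N (Suc n) = (p - y) * falling 1 N n"
    using falling_Suc_right[of 1 n N, where 'a='a] by (simp only: p_def q_def y_def mult_1_left)
  note step = telescope_step_durfee[OF this, of e q u]
  have "(Suc n)\<^sup>2 = n\<^sup>2 + n * 2 + 1" by (simp add: power2_eq_square)
  then have pw: "q ^ (Suc n)\<^sup>2 = e * p\<^sup>2 * q"
    "q ^ Suc n = q * p" "q ^ Suc (Suc n) = q\<^sup>2 * p" "q ^ Suc N = q * y"
    by (simp_all add: power_add power_mult e_def p_def y_def power2_eq_square)
  show ?case
    unfolding sum.lessThan_Suc add.assoc[symmetric] Suc.IH
    unfolding q_def[symmetric] pw
    unfolding i u_def[symmetric] p_def[symmetric] y_def[symmetric] e_def[symmetric]
    using step by (simp only: mult_ac)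
qed simp

definition mixed_sum :: "nat \<Rightarrow> 'a::field fps" where
  "mixed_sum L = (\<Sum>s\<le>L. falling 3 L s * mixed_term s)"

lemma durfee_sum_diff:
  "durfee_sum 3 1 (Suc L) - durfee_sum 3 0 (Suc L) = (1 - fps_X ^ (3 * Suc L)) * (mixed_sum L :: 'a::field fps)"
proof -
  have "fps_X ^ ((Suc s)\<^sup>2 - 1 * Suc s) * (inv_qpoch (Suc s))\<^sup>2 - fps_X ^ ((Suc s)\<^sup>2 - 0 * Suc s) * (inv_qpoch (Suc s))\<^sup>2
      = (mixed_term s :: 'a fps)" for s
  proof -
    have e: "(Suc s)\<^sup>2 - 1 * Suc s = s\<^sup>2 + s" "(Suc s)\<^sup>2 - 0 * Suc s = s\<^sup>2 + s + Suc s"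
      by (simp_all add: power2_eq_square)
    show ?thesis
      unfolding e power_add inv_qpoch_Suc[of s, symmetric] by algebra
  qed
  then show ?thesis
    unfolding durfee_sum_Suc mixed_sum_def
    by (simp only: add_diff_add diff_self add_0_left mult.assoc flip: right_diff_distrib sum_subtractf)
qed

lemma durfee_sum_rec_diff:
  "durfee_sum 3 1 (Suc L) - durfee_sum 3 0 (Suc L) =
    fps_X * fps_X ^ (3 * L) * durfee_sum 3 1 L + (1 + fps_X\<^sup>2 * fps_X ^ (3 * L)) * (durfee_sum 3 0 L :: 'a::field fps)"
proof -
  have "(1 - fps_X ^ (3 * Suc L)) * mixed_sum L -
      (fps_X * fps_X ^ (3 * L) * durfee_sum 3 1 L + (1 + fps_X\<^sup>2 * fps_X ^ (3 * L)) * durfee_sum 3 0 L) =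
    (\<Sum>s<Suc L. (1 - fps_X ^ (3 * Suc L)) * falling 3 L s * mixed_term s
      - falling 3 L s * (fps_X * fps_X ^ (3 * L) * (fps_X ^ (s\<^sup>2 - s) * (inv_qpoch s)\<^sup>2)
         + (1 + fps_X\<^sup>2 * fps_X ^ (3 * L)) * (fps_X ^ s\<^sup>2 * (inv_qpoch s)\<^sup>2)) :: 'a fps)"
    unfolding lessThan_Suc_atMost mixed_sum_def durfee_sum_def
    by (simp only: sum_subtractf sum_distrib_left distrib_left sum.distrib) (simp add: mult_ac)
  also have "\<dots> = 0"
    unfolding telescope_diff by (simp add: falling_eq_0)
  finally show ?thesis
    unfolding durfee_sum_diff by (simp only: right_minus_eq)
qed

text \<open>Together with \<open>durfee_sum_rec_diff\<close> this determines both sums for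
  \<open>L + 1\<close> from those for \<open>L\<close>. The factor on the left is the one that turns
  \<open>mixed_sum L\<close> into the difference of the two sums.\<close>

lemma durfee_sum_rec:
  "(1 - fps_X ^ (3 * Suc L)) * (durfee_sum 3 0 (Suc L) - fps_X\<^sup>2 * fps_X ^ (3 * L) * durfee_sum 3 0 L) =
    (1 + 2 * fps_X ^ (3 * Suc L)) * (durfee_sum 3 1 (Suc L) - (durfee_sum 3 0 (Suc L) :: 'a::field fps))"
proof -
  have "durfee_sum 3 0 (Suc L) - fps_X\<^sup>2 * fps_X ^ (3 * L) * durfee_sum 3 0 L - (1 + 2 * fps_X ^ (3 * Suc L)) * mixed_sum L =
    1 + (\<Sum>s<Suc L. (1 - fps_X ^ (3 * Suc L)) * falling 3 L s * (fps_X ^ (Suc s)\<^sup>2 * (inv_qpoch (Suc s))\<^sup>2)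
      - fps_X\<^sup>2 * fps_X ^ (3 * L) * falling 3 L s * (fps_X ^ s\<^sup>2 * (inv_qpoch s)\<^sup>2)
      - (1 + 2 * fps_X ^ (3 * Suc L)) * falling 3 L s * (mixed_term s :: 'a fps))"
    unfolding lessThan_Suc_atMost durfee_sum_Suc unfolding mixed_sum_def durfee_sum_def
    by (simp only: sum_subtractf sum_distrib_left) (simp add: mult_ac)
  also have "\<dots> = 0"
    unfolding telescope_rec by (simp add: falling_eq_0)
  finally have "durfee_sum 3 0 (Suc L) - fps_X\<^sup>2 * fps_X ^ (3 * L) * durfee_sum 3 0 L
      = (1 + 2 * fps_X ^ (3 * Suc L)) * (mixed_sum L :: 'a fps)"
    by simp
  then show ?thesis
    unfolding durfee_sum_diff by (simp only: mult_ac)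
qed

text \<open>Finite Durfee identity: \<open>falling 1 N s * inv_qpoch s\<close> is a Gaussian
  binomial coefficient, and the sum classifies partitions into at most \<open>N\<close> parts by
  their Durfee square.\<close>

lemma durfee_sum_1_0: "durfee_sum 1 0 N = (inv_qpoch N :: 'a::field fps)"
proof (induction N)
  case (Suc N)
  have "(1 - fps_X ^ Suc N) * durfee_sum 1 0 (Suc N) - durfee_sum 1 0 N =
    ((1 - fps_X ^ Suc N) + (\<Sum>s<Suc N. (1 - fps_X ^ Suc N)\<^sup>2 * falling 1 N s * (fps_X ^ (Suc s)\<^sup>2 * (inv_qpoch (Suc s))\<^sup>2)
      - falling 1 N s * (fps_X ^ s\<^sup>2 * (inv_qpoch s)\<^sup>2)) :: 'a fps)"
    unfolding lessThan_Suc_atMost durfee_sum_Suc unfolding durfee_sum_def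
    by (simp only: sum_subtractf sum_distrib_left distrib_left power2_eq_square) (simp add: mult_ac)
  also have "\<dots> = 0"
    unfolding telescope_durfee by (simp add: falling_eq_0)
  finally have "(1 - fps_X ^ Suc N) * durfee_sum 1 0 (Suc N) = (1 - fps_X ^ Suc N) * (inv_qpoch (Suc N) :: 'a fps)"
    using Suc.IH inv_qpoch_Suc[of N, where 'a='a] by (simp only: mult.commute right_minus_eq)
  then show ?case using one_minus_X_power_neq_0[of N, where 'a='a] by simp
qed simp

section \<open>Coefficientwise limit of the Durfee sums\<close>

text \<open>Each factor of \<open>falling\<close> is 1 modulo \<open>q^(L-s+1)\<close>, and the
  shift by \<open>q^(s^2)\<close> with \<open>s \<le> s^2\<close> moves the deviation beyond degree
  \<open>n\<close>.\<close>

lemma falling_X_power_nth: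
  assumes "k \<ge> 1" "s \<le> L" "n \<le> L"
  shows "fps_nth (falling k L s * fps_X ^ s\<^sup>2 * f) n = fps_nth (fps_X ^ s\<^sup>2 * f :: 'a::field fps) n"
proof -
  have "fps_nth (falling k L s * g) m = fps_nth g m" if "m + s \<le> L" for g :: "'a fps" and m
    using that
  proof (induction s arbitrary: m g)
    case (Suc s)
    have "k * (L - s) > m"
      using Suc.prems assms(1) by (metis Suc_le_lessD add_Suc_right less_diff_conv less_le_trans mult_le_mono1 nat_mult_1)
    moreover have "falling k L (Suc s) * g = falling k L s * ((1 - fps_X ^ (k * (L - s))) * g)"
      by (simp add: falling_def mult.assoc)
    ultimately show ?case
      using Suc by (simp add: left_diff_distrib fps_X_power_mult_nth)
  qed simp
  moreover have "n - s\<^sup>2 + s \<le> L" if "s\<^sup>2 \<le> n"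
  proof -
    have "s \<le> s\<^sup>2" by (simp add: power2_eq_square)
    then show ?thesis using that assms by linarith
  qed
  moreover have "falling k L s * fps_X ^ s\<^sup>2 * f = fps_X ^ s\<^sup>2 * (falling k L s * f)"
    by (simp add: mult_ac)
  ultimately show ?thesis
    by (simp only: fps_X_power_mult_nth not_less split: if_split) simp
qed

text \<open>Up to degree \<open>L\<close> the sum does not depend on \<open>k \<ge> 1\<close>, so
  \<open>k = 3\<close> may be replaced by \<open>k = 1\<close>, where \<open>durfee_sum_1_0\<close>
  applies.\<close>

lemma durfee_sum_3_nth:
  assumes "n \<le> L"
  shows "fps_nth (durfee_sum 3 0 L) n = fps_nth (inv_qpoch L :: 'a::field fps) n"
proof -
  have "fps_nth (durfee_sum k 0 L :: 'a fps) n = (\<Sum>s\<le>L. fps_nth (fps_X ^ s\<^sup>2 * (inv_qpoch s)\<^sup>2) n)" if "k \<ge> 1" for k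
    unfolding durfee_sum_def fps_sum_nth
    by (intro sum.cong refl) (simp only: falling_X_power_nth[OF that _ assms] atMost_iff mult_zero_left diff_zero)
  from this[of 3] this[of 1] show ?thesis by (simp add: durfee_sum_1_0[unfolded One_nat_def])
qed

section \<open>Generating functions of weighted sets\<close>

text \<open>\<open>card\<close> is 0 on infinite sets, hence the finiteness assumptions in the sum
  rules below.\<close>

definition gf :: "('a \<Rightarrow> nat) \<Rightarrow> 'a set \<Rightarrow> 'b::semiring_1 fps" where
  "gf w S = Abs_fps (\<lambda>n. of_nat (card {x \<in> S. w x = n}))"

lemma gf_nth: "fps_nth (gf w S) n = of_nat (card {x \<in> S. w x = n})"
  by (simp add: gf_def)

lemma gf_union:
  assumes "\<And>n. finite {x \<in> S. w x = n}" "\<And>n. finite {x \<in> T. w x = n}" "S \<inter> T = {}"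
  shows "gf w (S \<union> T) = gf w S + (gf w T :: 'b::semiring_1 fps)"
proof (rule fps_ext)
  fix n
  have "{x \<in> S \<union> T. w x = n} = {x \<in> S. w x = n} \<union> {x \<in> T. w x = n}" by auto
  then have "card {x \<in> S \<union> T. w x = n} = card {x \<in> S. w x = n} + card {x \<in> T. w x = n}"
    using card_Un_disjoint[OF assms(1,2)] assms(3) by auto
  then show "fps_nth (gf w (S \<union> T)) n = fps_nth (gf w S + gf w T :: 'b fps) n"
    by (simp add: gf_nth)
qed

lemma gf_UN:
  assumes "finite I" "\<And>i n. i \<in> I \<Longrightarrow> finite {x \<in> S i. w x = n}"
    and "\<And>i j. i \<in> I \<Longrightarrow> j \<in> I \<Longrightarrow> i \<noteq> j \<Longrightarrow> S i \<inter> S j = {}"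
  shows "gf w (\<Union>i\<in>I. S i) = (\<Sum>i\<in>I. gf w (S i) :: 'b::semiring_1 fps)"
  using assms
proof (induction I rule: finite_induct)
  case empty
  then show ?case by (auto intro!: fps_ext simp: gf_nth)
next
  case (insert i I)
  have "finite {x \<in> (\<Union>i\<in>I. S i). w x = n}" for n
    using finite_UN_I[OF insert.hyps(1), of "\<lambda>i. {x \<in> S i. w x = n}"] insert.prems(1)
    by (simp add: UN_extend_simps Collect_ex_eq[symmetric] finite_subset[rotated] subset_iff)
  moreover have "S i \<inter> (\<Union>i\<in>I. S i) = {}"
    using insert by blast
  ultimately show ?case
    using insert by (simp add: gf_union)
qed

lemma gf_image:
  assumes "inj_on f S" "\<And>x. x \<in> S \<Longrightarrow> w (f x) = w x + d"
  shows "gf w (f ` S) = fps_X ^ d * (gf w S :: 'b::comm_semiring_1 fps)"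
proof (rule fps_ext)
  fix n
  have "{y \<in> f ` S. w y = n} = (if n < d then {} else f ` {x \<in> S. w x = n - d})"
    using assms(2) by auto
  moreover have "card (f ` {x \<in> S. w x = n - d}) = card {x \<in> S. w x = n - d}"
    by (rule card_image) (use assms(1) in \<open>auto simp: inj_on_def\<close>)
  ultimately show "fps_nth (gf w (f ` S)) n = fps_nth (fps_X ^ d * gf w S :: 'b fps) n"
    by (simp add: gf_nth fps_X_power_mult_nth)
qed

section \<open>Lists with difference conditions\<close>

lemma colors_eq: "colors = {1, 2, 3, 4, 5, 6, 7, 8, 9}"
  by (auto simp: colors_def)

lemma E_le_2: "a \<in> colors \<Longrightarrow> b \<in> colors \<Longrightarrow> E a b \<le> 2"
  unfolding colors_eq by (auto simp: E_def E_rows_def)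

text \<open>Within one level a chain can therefore only pass to an equal or larger colour, so
  sorting recovers the order of its parts.\<close>

lemma E_eq_0_imp_ge: "a \<in> colors \<Longrightarrow> b \<in> colors \<Longrightarrow> E a b = 0 \<Longrightarrow> b \<le> a"
  unfolding colors_eq by (auto simp: E_def E_rows_def)

lemma E_ge_1: "a \<in> colors \<Longrightarrow> b \<in> colors \<Longrightarrow> a \<le> 3 \<Longrightarrow> 1 \<le> E a b"
  unfolding colors_eq by (auto simp: E_def E_rows_def)

lemma E_4: "a \<in> colors \<Longrightarrow> E a 4 = (if a = 4 then 0 else 1)"
  unfolding colors_eq by (auto simp: E_def E_rows_def)

text \<open>Extends the condition between neighbours of a chain to arbitrary pairs; a finite check
  over all triples of colours.\<close>

lemma E_triangle:
  assumes "a \<in> colors" "b \<in> colors" "c \<in> colors"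
  shows "E a c \<le> E a b + E b c"
proof -
  have "\<forall>a\<in>set [1..<10]. \<forall>b\<in>set [1..<10]. \<forall>c\<in>set [1..<10]. E a c \<le> E a b + E b c"
    by code_simp
  moreover have "colors = set [1..<10]"
    by (auto simp: colors_def)
  ultimately show ?thesis using assms by blast
qed

text \<open>The degree of \<open>(-i)\<^sub>c\<close> is \<open>3 * i + offset c - 2\<close>.\<close>

definition offset :: "nat \<Rightarrow> nat" where
  "offset c = (if c = 1 then 0 else if c \<in> {2, 3} then 1 else if c \<in> {4, 5, 6} then 2
    else if c \<in> {7, 8} then 3 else 4)"

text \<open>The subtraction truncates only at level 0 for colours 1 to 3;
  \<open>diff_chain_offset\<close> excludes these pairs from chains.\<close>

definition deg :: "nat \<times> nat \<Rightarrow> nat" where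
  "deg x = 3 * snd x + offset (fst x) - 2"

abbreviation weight :: "(nat \<times> nat) list \<Rightarrow> nat" where
  "weight xs \<equiv> sum_list (map deg xs)"

text \<open>List elements are pairs of a colour and a level \<open>i\<close>, standing for the part of index \<open>-i\<close>; level 0 is allowed.\<close>

fun diff_chain :: "nat \<times> nat \<Rightarrow> (nat \<times> nat) list \<Rightarrow> bool" where
  "diff_chain x [] \<longleftrightarrow> True"
| "diff_chain x (y # ys) \<longleftrightarrow> fst y \<in> colors \<and> snd x + E (fst y) (fst x) \<le> snd y \<and> diff_chain y ys"

definition diff_chains :: "nat \<Rightarrow> nat \<Rightarrow> (nat \<times> nat) list set" where
  "diff_chains L b = {xs. length xs = L \<and> diff_chain (b, 0) xs}"

definition shift :: "nat \<Rightarrow> (nat \<times> nat) list \<Rightarrow> (nat \<times> nat) list" where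
  "shift k = map (apsnd (\<lambda>i. i + k))"

lemma inj_shift: "inj (shift k)"
  unfolding shift_def by (intro inj_mapI injI) (auto simp: prod_eq_iff)

lemma length_shift [simp]: "length (shift k xs) = length xs"
  by (simp add: shift_def)

lemma diff_chain_shift: "diff_chain (b, j + k) (shift k xs) \<longleftrightarrow> diff_chain (b, j) xs"
  by (induction xs arbitrary: b j) (auto simp: shift_def)

lemma diff_chain_imp_shift:
  assumes "diff_chain (b, j + k) xs"
  obtains ys where "xs = shift k ys" "diff_chain (b, j) ys"
proof -
  have "\<exists>ys. xs = shift k ys"
    using assms
  proof (induction xs arbitrary: b j)
    case (Cons x xs)
    obtain c i where x: "x = (c, i)" by fastforce
    with Cons.prems obtain i' where i': "i = i' + k" by (auto dest: le_Suc_ex)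
    with Cons x obtain ys where "xs = shift k ys" by fastforce
    with x i' have "x # xs = shift k ((c, i') # ys)" by (simp add: shift_def)
    then show ?case by blast
  qed (simp add: shift_def)
  with assms that diff_chain_shift show ?thesis by blast
qed

lemma diff_chain_color: "diff_chain x xs \<Longrightarrow> y \<in> set xs \<Longrightarrow> fst y \<in> colors"
  by (induction xs arbitrary: x) auto

text \<open>Colours 1 to 3 have offset below 2, but their rows of \<open>E\<close> contain no 0,
  which forces level at least 1.\<close>

lemma diff_chain_offset:
  assumes "diff_chain x xs" "fst x \<in> colors" "y \<in> set xs"
  shows "2 \<le> 3 * snd y + offset (fst y)"
  using assms
proof (induction xs arbitrary: x)
  case (Cons z zs)
  have "2 \<le> 3 * snd z + offset (fst z)"
  proof (cases "fst z \<le> 3")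
    case True
    then have "1 \<le> E (fst z) (fst x)" using Cons.prems by (intro E_ge_1) auto
    with Cons.prems show ?thesis by auto
  qed (auto simp: offset_def)
  then show ?case using Cons.IH[of z] Cons.prems by auto
qed simp

lemma weight_shift:
  assumes "diff_chain x xs" "fst x \<in> colors"
  shows "weight (shift k xs) = weight xs + 3 * k * length xs"
  using assms
proof (induction xs arbitrary: x)
  case (Cons y ys)
  have "deg (apsnd (\<lambda>i. i + k) y) = deg y + 3 * k"
    using diff_chain_offset[OF Cons.prems, of y] by (simp add: deg_def)
  moreover have "weight (shift k ys) = weight ys + 3 * k * length ys"
    using Cons.IH[of y] Cons.prems by simp
  ultimately show ?case by (simp add: shift_def)
qed (simp add: shift_def)

lemma level_le_deg: "2 \<le> 3 * snd x + offset (fst x) \<Longrightarrow> snd x \<le> deg x"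
  by (cases "snd x") (auto simp: deg_def)

lemma finite_chains:
  assumes "b \<in> colors"
  shows "finite {xs \<in> diff_chains L b. weight xs = n}"
proof (rule finite_subset)
  show "{xs \<in> diff_chains L b. weight xs = n} \<subseteq> {xs. set xs \<subseteq> colors \<times> {..n} \<and> length xs = L}"
  proof clarify
    fix xs assume xs: "xs \<in> diff_chains L b" "n = weight xs"
    have "snd x \<le> weight xs" if "x \<in> set xs" for x
      using level_le_deg[OF diff_chain_offset[of "(b, 0)" xs x]] that assms xs
        member_le_sum_list[of "deg x" "map deg xs"]
      by (fastforce simp: diff_chains_def)
    with xs show "set xs \<subseteq> colors \<times> {..weight xs} \<and> length xs = L"
      by (fastforce simp: diff_chains_def dest: diff_chain_color)
  qed
  show "finite {xs. set xs \<subseteq> colors \<times> {..n} \<and> length xs = L}"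
    by (intro finite_lists_length_eq) (simp add: colors_def)
qed

section \<open>Decomposition of chains by their first part\<close>

abbreviation cons_min :: "nat \<Rightarrow> nat \<Rightarrow> (nat \<times> nat) list \<Rightarrow> (nat \<times> nat) list" where
  "cons_min b c ys \<equiv> (c, E c b) # shift (E c b) ys"

text \<open>Either the first part has the least possible level, or all levels can be lowered by one.\<close>

lemma diff_chains_Suc:
  "diff_chains (Suc L) b = (\<Union>c\<in>colors. cons_min b c ` diff_chains L c) \<union> shift 1 ` diff_chains (Suc L) b"
proof (intro equalityI subsetI)
  fix xs assume xs: "xs \<in> diff_chains (Suc L) b"
  then obtain c i ys where [simp]: "xs = (c, i) # ys"
    by (cases xs) (auto simp: diff_chains_def)
  have c: "c \<in> colors" "E c b \<le> i" "diff_chain (c, i) ys" "length ys = L"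
    using xs by (auto simp: diff_chains_def)
  show "xs \<in> (\<Union>c\<in>colors. cons_min b c ` diff_chains L c) \<union> shift 1 ` diff_chains (Suc L) b"
  proof (cases "i = E c b")
    case True
    then obtain zs where "ys = shift (E c b) zs" "diff_chain (c, 0) zs"
      using diff_chain_imp_shift[of c 0 "E c b" ys] c by auto
    then show ?thesis using c True by (auto simp: diff_chains_def)
  next
    case False
    with c obtain i' where i': "i = i' + 1" "E c b \<le> i'"
      by (metis Suc_eq_plus1 le_neq_implies_less less_imp_Suc_add le_add1 add.commute plus_nat.add_Suc)
    then obtain zs where zs: "ys = shift 1 zs" "diff_chain (c, i') zs"
      using diff_chain_imp_shift c by blast
    then have "(c, i') # zs \<in> diff_chains (Suc L) b" "xs = shift 1 ((c, i') # zs)"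
      using c i' by (auto simp: diff_chains_def shift_def)
    then show ?thesis by blast
  qed
next
  fix xs assume "xs \<in> (\<Union>c\<in>colors. cons_min b c ` diff_chains L c) \<union> shift 1 ` diff_chains (Suc L) b"
  then show "xs \<in> diff_chains (Suc L) b"
  proof
    assume "xs \<in> (\<Union>c\<in>colors. cons_min b c ` diff_chains L c)"
    then show ?thesis
      using diff_chain_shift[of _ 0] by (auto simp: diff_chains_def)
  next
    assume "xs \<in> shift 1 ` diff_chains (Suc L) b"
    then obtain c i ys where "xs = shift 1 ((c, i) # ys)" "(c, i) # ys \<in> diff_chains (Suc L) b"
      by (auto simp: diff_chains_def length_Suc_conv)
    then show ?thesis
      using diff_chain_shift[of c i 1 ys] by (auto simp: diff_chains_def shift_def)
  qed
qed

lemma gf_diff_chains_0: "gf weight (diff_chains 0 b) = 1"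
proof (rule fps_ext)
  fix n
  have "{xs \<in> diff_chains 0 b. weight xs = n} = (if n = 0 then {[]} else {})"
    by (auto simp: diff_chains_def)
  then show "fps_nth (gf weight (diff_chains 0 b)) n = fps_nth (1 :: 'a fps) n"
    by (simp add: gf_nth)
qed

text \<open>The exponent collects the degree \<open>3 * E c b + offset c - 2\<close> of the first
  part and \<open>3 * E c b * L\<close> from raising the other \<open>L\<close> parts.\<close>

lemma gf_diff_chains_Suc:
  assumes b: "b \<in> colors"
  shows "gf weight (diff_chains (Suc L) b) =
    (\<Sum>c\<in>colors. fps_X ^ (3 * E c b * Suc L + offset c - 2) * gf weight (diff_chains L c))
    + fps_X ^ (3 * Suc L) * (gf weight (diff_chains (Suc L) b) :: 'b::comm_semiring_1 fps)"
proof -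
  let ?U = "\<Union>c\<in>colors. cons_min b c ` diff_chains L c"
  have sub: "?U \<subseteq> diff_chains (Suc L) b" "shift 1 ` diff_chains (Suc L) b \<subseteq> diff_chains (Suc L) b"
    using diff_chains_Suc by blast+
  have fin: "finite {xs \<in> S. weight xs = n}" if "S \<subseteq> diff_chains (Suc L) b" for S n
    by (rule finite_subset[OF _ finite_chains[OF b, of "Suc L" n]]) (use that in blast)
  have disj: "?U \<inter> shift 1 ` diff_chains (Suc L) b = {}"
  proof -
    \<comment> \<open>A chain after \<open>(b, 0)\<close> with first colour \<open>c\<close> starts
      at level at least \<open>E c b\<close>, so its shift starts strictly higher.\<close>
    have "cons_min b c ys \<noteq> shift 1 xs" if "xs \<in> diff_chains (Suc L) b" for c xs ys
      using that by (cases xs) (auto simp: diff_chains_def shift_def)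
    then show ?thesis by blast
  qed
  have "gf weight (diff_chains (Suc L) b) = gf weight ?U + (gf weight (shift 1 ` diff_chains (Suc L) b) :: 'b fps)"
    by (subst diff_chains_Suc) (intro gf_union fin sub disj)
  also have "gf weight (shift 1 ` diff_chains (Suc L) b) = fps_X ^ (3 * Suc L) * (gf weight (diff_chains (Suc L) b) :: 'b fps)"
    using b by (intro gf_image inj_on_subset[OF inj_shift]) (auto simp: diff_chains_def weight_shift[of "(b, 0)"])
  also have "gf weight ?U = (\<Sum>c\<in>colors. gf weight (cons_min b c ` diff_chains L c) :: 'b fps)"
  proof (rule gf_UN)
    show "finite colors" by (simp add: colors_def)
    show "finite {xs \<in> cons_min b c ` diff_chains L c. weight xs = n}" if "c \<in> colors" for c n
      using sub(1) that by (intro fin) blast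
  qed auto
  also have "\<dots> = (\<Sum>c\<in>colors. fps_X ^ (3 * E c b * Suc L + offset c - 2) * gf weight (diff_chains L c))"
  proof (intro sum.cong refl gf_image)
    fix c assume c: "c \<in> colors"
    show "inj_on (cons_min b c) (diff_chains L c)"
      using inj_shift by (auto simp: inj_on_def)
    fix ys assume ys: "ys \<in> diff_chains L c"
    have "2 \<le> 3 * E c b + offset c"
      using diff_chain_offset[of "(b, 0)" "[(c, E c b)]"] b c by simp
    with ys c show "weight (cons_min b c ys) = weight ys + (3 * E c b * Suc L + offset c - 2)"
      by (auto simp: diff_chains_def weight_shift[of "(c, 0)"] deg_def algebra_simps)
  qed
  finally show ?thesis .
qed

section \<open>Solution of the recurrence\<close>

definition closed_form :: "nat \<Rightarrow> nat \<Rightarrow> 'a::field fps" where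
  "closed_form L b =
    (if b = 1 then durfee_sum 3 1 L
     else if b \<in> {7, 8} then fps_X ^ (3 * L) * durfee_sum 3 1 L
     else if b = 9 then fps_X ^ (3 * L) * durfee_sum 3 0 L
     else durfee_sum 3 0 L)"

lemma closed_form_Suc:
  assumes "b \<in> colors"
  shows "(1 - fps_X ^ (3 * Suc L)) * closed_form (Suc L) b =
    (\<Sum>c\<in>colors. fps_X ^ (3 * E c b * Suc L + offset c - 2) * (closed_form L c :: 'a::field fps))"
proof -
  define q A B A' B' \<zeta> where "q = (fps_X :: 'a fps)" and "A = (durfee_sum 3 1 L :: 'a fps)" and "B = (durfee_sum 3 0 L :: 'a fps)"
    and "A' = (durfee_sum 3 1 (Suc L) :: 'a fps)" and "B' = (durfee_sum 3 0 (Suc L) :: 'a fps)" and "\<zeta> = q ^ (3 * L)"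
  have z: "q ^ (3 * Suc L) = q ^ 3 * \<zeta>"
    by (simp add: \<zeta>_def power_add)
  \<comment> \<open>The two recurrences form a linear system for \<open>A'\<close> and
    \<open>B'\<close>, solved below up to the factor \<open>1 - q ^ 3 * \<zeta>\<close>.\<close>
  have d: "A' - B' = q * \<zeta> * A + (1 + q\<^sup>2 * \<zeta>) * B"
    using durfee_sum_rec_diff[of L, where 'a='a] unfolding A_def B_def A'_def B'_def q_def \<zeta>_def .
  have AB'1: "(1 - q ^ 3 * \<zeta>) * (B' - q\<^sup>2 * \<zeta> * B) =
      (1 + 2 * (q ^ 3 * \<zeta>)) * (q * \<zeta> * A + (1 + q\<^sup>2 * \<zeta>) * B)"
    using durfee_sum_rec[of L, where 'a='a]
    unfolding A_def[symmetric] B_def[symmetric] A'_def[symmetric] B'_def[symmetric] q_def[symmetric] z d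
      \<zeta>_def[symmetric] .
  have AB'2: "A' = B' + (q * \<zeta> * A + (1 + q\<^sup>2 * \<zeta>) * B)"
    unfolding d[symmetric] by simp
  have B': "(1 - q ^ 3 * \<zeta>) * B' = q * \<zeta> * (1 + 2 * q ^ 3 * \<zeta>) * A
      + (1 + 2 * q ^ 3 * \<zeta> + 2 * q\<^sup>2 * \<zeta> + q ^ 5 * \<zeta>\<^sup>2) * B"
    using AB'1 by algebra
  have A': "(1 - q ^ 3 * \<zeta>) * A' = q * \<zeta> * (q ^ 3 * \<zeta> + 2) * A + (2 + q ^ 3 * \<zeta> + 3 * q\<^sup>2 * \<zeta>) * B"
    unfolding AB'2 distrib_left[of _ B'] B' by algebra
  \<comment> \<open>The factor \<open>q\<^sup>2\<close> removes the truncated subtraction from the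
    exponents; it is cancelled at the end.\<close>
  have "q\<^sup>2 * q ^ (3 * E c b * Suc L + offset c - 2) = (q ^ 3 * \<zeta>) ^ E c b * q ^ offset c" if "c \<in> colors" for c
  proof -
    have "2 \<le> 3 * E c b + offset c"
      using diff_chain_offset[of "(b, 0)" "[(c, E c b)]"] assms that by simp
    then have "2 \<le> 3 * E c b * Suc L + offset c"
      unfolding mult_Suc_right by linarith
    then have "2 + (3 * E c b * Suc L + offset c - 2) = 3 * Suc L * E c b + offset c"
      by (simp only: le_add_diff_inverse) (simp only: mult_ac)
    moreover have "q ^ (3 * Suc L * E c b + offset c) = (q ^ (3 * Suc L)) ^ E c b * q ^ offset c"
      by (simp only: power_add power_mult)
    ultimately show ?thesis
      unfolding z power_add[symmetric] by simp
  qed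
  then have "q\<^sup>2 * (\<Sum>c\<in>colors. q ^ (3 * E c b * Suc L + offset c - 2) * closed_form L c) =
      (\<Sum>c\<in>colors. (q ^ 3 * \<zeta>) ^ E c b * q ^ offset c * closed_form L c)"
    unfolding sum_distrib_left by (intro sum.cong) (simp_all only: mult.assoc[symmetric])
  also have "\<dots> = q\<^sup>2 * ((1 - q ^ 3 * \<zeta>) * closed_form (Suc L) b)"
  proof -
    have cf: "closed_form L 1 = A" "closed_form L 2 = B" "closed_form L 3 = B" "closed_form L 4 = B"
      "closed_form L 5 = B" "closed_form L 6 = B" "closed_form L 7 = \<zeta> * A" "closed_form L 8 = \<zeta> * A"
      "closed_form L 9 = \<zeta> * B"
      by (simp_all add: closed_form_def A_def B_def \<zeta>_def q_def)
    have cf': "closed_form (Suc L) 1 = A'" "closed_form (Suc L) 2 = B'" "closed_form (Suc L) 3 = B'" "closed_form (Suc L) 4 = B'"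
      "closed_form (Suc L) 5 = B'" "closed_form (Suc L) 6 = B'" "closed_form (Suc L) 7 = q ^ 3 * \<zeta> * A'"
      "closed_form (Suc L) 8 = q ^ 3 * \<zeta> * A'" "closed_form (Suc L) 9 = q ^ 3 * \<zeta> * B'"
      unfolding z[symmetric] by (simp_all only: closed_form_def A'_def B'_def q_def) simp_all
    have off: "offset 1 = 0" "offset 2 = 1" "offset 3 = 1" "offset 4 = 2" "offset 5 = 2" "offset 6 = 2"
      "offset 7 = 3" "offset 8 = 3" "offset 9 = 4"
      by (simp_all add: offset_def)
    have S: "(\<Sum>c\<in>colors. (q ^ 3 * \<zeta>) ^ E c b * q ^ offset c * closed_form L c) =
      (q ^ 3 * \<zeta>) ^ E 1 b * A + (q ^ 3 * \<zeta>) ^ E 2 b * q * B + (q ^ 3 * \<zeta>) ^ E 3 b * q * B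
      + (q ^ 3 * \<zeta>) ^ E 4 b * q\<^sup>2 * B + (q ^ 3 * \<zeta>) ^ E 5 b * q\<^sup>2 * B + (q ^ 3 * \<zeta>) ^ E 6 b * q\<^sup>2 * B
      + (q ^ 3 * \<zeta>) ^ E 7 b * q ^ 3 * \<zeta> * A + (q ^ 3 * \<zeta>) ^ E 8 b * q ^ 3 * \<zeta> * A
      + (q ^ 3 * \<zeta>) ^ E 9 b * q ^ 4 * \<zeta> * B"
      unfolding colors_eq by (simp add: cf[simplified] off[simplified] add.assoc mult.assoc)
    \<comment> \<open>Inserting column \<open>b\<close> of \<open>E\<close> leaves a polynomial
      identity in \<open>q\<close>, \<open>\<zeta>\<close>, \<open>A\<close> and
      \<open>B\<close>.\<close>
    consider "b = 1" | "b = 2" | "b = 3" | "b = 4" | "b = 5" | "b = 6" | "b = 7" | "b = 8" | "b = 9"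
      using assms unfolding colors_eq by blast
    then show ?thesis
    proof cases
      case 1
      have e: "E 1 1 = 2" "E 2 1 = 1" "E 3 1 = 1" "E 4 1 = 1" "E 5 1 = 0"
          "E 6 1 = 0" "E 7 1 = 0" "E 8 1 = 0" "E 9 1 = 0"
        by (simp_all add: E_def E_rows_def)
      have "(1 - q ^ 3 * \<zeta>) * closed_form (Suc L) b = ((1 - q ^ 3 * \<zeta>) * A')"
        unfolding \<open>b = 1\<close> cf' by (simp only: mult_ac)
      then show ?thesis
        unfolding S unfolding \<open>b = 1\<close> e A' by algebra
    next
      case 2
      have e: "E 1 2 = 2" "E 2 2 = 2" "E 3 2 = 1" "E 4 2 = 1" "E 5 2 = 0"
          "E 6 2 = 1" "E 7 2 = 1" "E 8 2 = 0" "E 9 2 = 0"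
        by (simp_all add: E_def E_rows_def)
      have "(1 - q ^ 3 * \<zeta>) * closed_form (Suc L) b = ((1 - q ^ 3 * \<zeta>) * B')"
        unfolding \<open>b = 2\<close> cf' by (simp only: mult_ac)
      then show ?thesis
        unfolding S unfolding \<open>b = 2\<close> e B' by algebra
    next
      case 3
      have e: "E 1 3 = 2" "E 2 3 = 1" "E 3 3 = 2" "E 4 3 = 1" "E 5 3 = 1"
          "E 6 3 = 0" "E 7 3 = 0" "E 8 3 = 1" "E 9 3 = 0"
        by (simp_all add: E_def E_rows_def)
      have "(1 - q ^ 3 * \<zeta>) * closed_form (Suc L) b = ((1 - q ^ 3 * \<zeta>) * B')"
        unfolding \<open>b = 3\<close> cf' by (simp only: mult_ac)
      then show ?thesis
        unfolding S unfolding \<open>b = 3\<close> e B' by algebra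
    next
      case 4
      have e: "E 1 4 = 1" "E 2 4 = 1" "E 3 4 = 1" "E 4 4 = 0" "E 5 4 = 1"
          "E 6 4 = 1" "E 7 4 = 1" "E 8 4 = 1" "E 9 4 = 1"
        by (simp_all add: E_def E_rows_def)
      have "(1 - q ^ 3 * \<zeta>) * closed_form (Suc L) b = ((1 - q ^ 3 * \<zeta>) * B')"
        unfolding \<open>b = 4\<close> cf' by (simp only: mult_ac)
      then show ?thesis
        unfolding S unfolding \<open>b = 4\<close> e B' by algebra
    next
      case 5
      have e: "E 1 5 = 2" "E 2 5 = 2" "E 3 5 = 1" "E 4 5 = 1" "E 5 5 = 0"
          "E 6 5 = 1" "E 7 5 = 1" "E 8 5 = 0" "E 9 5 = 0"
        by (simp_all add: E_def E_rows_def)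
      have "(1 - q ^ 3 * \<zeta>) * closed_form (Suc L) b = ((1 - q ^ 3 * \<zeta>) * B')"
        unfolding \<open>b = 5\<close> cf' by (simp only: mult_ac)
      then show ?thesis
        unfolding S unfolding \<open>b = 5\<close> e B' by algebra
    next
      case 6
      have e: "E 1 6 = 2" "E 2 6 = 1" "E 3 6 = 2" "E 4 6 = 1" "E 5 6 = 1"
          "E 6 6 = 0" "E 7 6 = 0" "E 8 6 = 1" "E 9 6 = 0"
        by (simp_all add: E_def E_rows_def)
      have "(1 - q ^ 3 * \<zeta>) * closed_form (Suc L) b = ((1 - q ^ 3 * \<zeta>) * B')"
        unfolding \<open>b = 6\<close> cf' by (simp only: mult_ac)
      then show ?thesis
        unfolding S unfolding \<open>b = 6\<close> e B' by algebra
    next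
      case 7
      have e: "E 1 7 = 2" "E 2 7 = 2" "E 3 7 = 2" "E 4 7 = 1" "E 5 7 = 1"
          "E 6 7 = 2" "E 7 7 = 2" "E 8 7 = 1" "E 9 7 = 1"
        by (simp_all add: E_def E_rows_def)
      have "(1 - q ^ 3 * \<zeta>) * closed_form (Suc L) b = q ^ 3 * \<zeta> * ((1 - q ^ 3 * \<zeta>) * A')"
        unfolding \<open>b = 7\<close> cf' by (simp only: mult_ac)
      then show ?thesis
        unfolding S unfolding \<open>b = 7\<close> e A' by algebra
    next
      case 8
      have e: "E 1 8 = 2" "E 2 8 = 2" "E 3 8 = 2" "E 4 8 = 1" "E 5 8 = 2"
          "E 6 8 = 1" "E 7 8 = 1" "E 8 8 = 2" "E 9 8 = 1"
        by (simp_all add: E_def E_rows_def)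
      have "(1 - q ^ 3 * \<zeta>) * closed_form (Suc L) b = q ^ 3 * \<zeta> * ((1 - q ^ 3 * \<zeta>) * A')"
        unfolding \<open>b = 8\<close> cf' by (simp only: mult_ac)
      then show ?thesis
        unfolding S unfolding \<open>b = 8\<close> e A' by algebra
    next
      case 9
      have e: "E 1 9 = 2" "E 2 9 = 2" "E 3 9 = 2" "E 4 9 = 1" "E 5 9 = 2"
          "E 6 9 = 2" "E 7 9 = 2" "E 8 9 = 2" "E 9 9 = 2"
        by (simp_all add: E_def E_rows_def)
      have "(1 - q ^ 3 * \<zeta>) * closed_form (Suc L) b = q ^ 3 * \<zeta> * ((1 - q ^ 3 * \<zeta>) * B')"
        unfolding \<open>b = 9\<close> cf' by (simp only: mult_ac)
      then show ?thesis
        unfolding S unfolding \<open>b = 9\<close> e B' by algebra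
    qed
  qed
  finally show ?thesis
    unfolding q_def[symmetric] z by (simp add: q_def)
qed

text \<open>Both families start with 1 and satisfy the same recurrence, which has a unique solution
  since \<open>1 - q^(3(L+1))\<close> can be cancelled.\<close>

lemma gf_diff_chains:
  assumes "b \<in> colors"
  shows "gf weight (diff_chains L b) = (closed_form L b :: 'a::field fps)"
  using assms
proof (induction L arbitrary: b)
  case 0
  then show ?case by (simp add: gf_diff_chains_0 closed_form_def)
next
  case (Suc L)
  define G :: "'a fps" where "G = gf weight (diff_chains (Suc L) b)"
  have "G = (1 - fps_X ^ (3 * Suc L)) * closed_form (Suc L) b + fps_X ^ (3 * Suc L) * G"
    unfolding G_def closed_form_Suc[OF Suc.prems]
    by (subst gf_diff_chains_Suc[OF Suc.prems]) (simp only: Suc.IH cong: sum.cong)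
  then have "(1 - fps_X ^ (3 * Suc L)) * G = (1 - fps_X ^ (3 * Suc L)) * closed_form (Suc L) b"
    by (metis add_diff_cancel_right' left_diff_distrib mult_1_left)
  moreover have "1 - fps_X ^ (3 * Suc L) \<noteq> (0 :: 'a fps)"
  proof -
    have "3 * Suc L = Suc (3 * L + 2)" by simp
    then show ?thesis by (metis one_minus_X_power_neq_0)
  qed
  ultimately show ?case by (simp only: mult_cancel_left G_def simp_thms)
qed

section \<open>Partitions as lists\<close>

definition separated :: "nat \<times> int \<Rightarrow> nat \<times> int \<Rightarrow> bool" where
  "separated p q \<longleftrightarrow> snd q + int (E (fst q) (fst p)) \<le> snd p"

definition to_part :: "nat \<times> nat \<Rightarrow> nat \<times> int" where
  "to_part x = (fst x, - int (snd x))"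

definition of_part :: "nat \<times> int \<Rightarrow> nat \<times> nat" where
  "of_part p = (fst p, nat (- snd p))"

text \<open>Level first, then colour: the factor 10 exceeds every colour, so distinct parts get
  distinct keys.\<close>

definition part_key :: "nat \<times> int \<Rightarrow> nat" where
  "part_key p = 10 * nat (- snd p) + fst p"

text \<open>In chains after \<open>(4, 0)\<close> the discarded pairs are padding, which lets
  partitions with fewer than \<open>L\<close> parts become lists of length \<open>L\<close>.\<close>

definition nonzero_parts :: "(nat \<times> nat) list \<Rightarrow> (nat \<times> int) list" where
  "nonzero_parts xs = map to_part (filter (\<lambda>x. snd x > 0) xs)"

lemma diff_chain_sorted:
  "diff_chain x xs \<Longrightarrow> fst x \<in> colors \<Longrightarrow> sorted_wrt (\<lambda>x y. separated (to_part x) (to_part y)) (x # xs)"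
proof (induction xs arbitrary: x)
  case (Cons y ys)
  have sorted: "sorted_wrt (\<lambda>x y. separated (to_part x) (to_part y)) (y # ys)"
    using Cons.IH[of y] Cons.prems by simp
  have "separated (to_part x) (to_part z)" if "z \<in> set (y # ys)" for z
  proof (cases "z = y")
    case False
    then have "separated (to_part y) (to_part z)" "fst z \<in> colors"
      using that sorted diff_chain_color[OF Cons.prems(1) that] by auto
    then show ?thesis
      using E_triangle[of "fst z" "fst y" "fst x"] Cons.prems by (auto simp: separated_def to_part_def)
  qed (use Cons.prems in \<open>auto simp: separated_def to_part_def\<close>)
  with sorted show ?case by simp
qed simp

lemma sorted_wrt_pair:
  "sorted_wrt R xs \<Longrightarrow> {#x, y#} \<subseteq># mset xs \<Longrightarrow> R x y \<or> R y x"
proof (induction xs)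
  case (Cons z zs)
  consider "z = x" | "z = y" | "z \<noteq> x" "z \<noteq> y" by blast
  then show ?case
  proof cases
    case 1
    with Cons.prems have "y \<in> set zs" by (simp add: insert_subset_eq_iff)
    with 1 Cons.prems show ?thesis by auto
  next
    case 2
    with Cons.prems have "{#y, x#} \<subseteq># add_mset y (mset zs)" by (simp add: add_mset_commute)
    then have "x \<in> set zs" by simp
    with 2 Cons.prems show ?thesis by auto
  next
    case 3
    with Cons.prems have "{#x, y#} \<subseteq># mset zs"
      by (auto simp: subseteq_mset_def split: if_splits)
    with Cons show ?thesis by auto
  qed
qed simp

lemma nonzero_parts_subset:
  assumes "diff_chain x xs"
  shows "set (nonzero_parts xs) \<subseteq> parts"
  using diff_chain_color[OF assms] by (auto simp: nonzero_parts_def to_part_def parts_def)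

lemma nonzero_parts_separated:
  assumes "diff_chain x xs" "fst x \<in> colors"
  shows "sorted_wrt separated (nonzero_parts xs)"
  using diff_chain_sorted[OF assms] by (simp add: nonzero_parts_def sorted_wrt_map sorted_wrt_filter)

lemma nonzero_parts_in_P_D:
  assumes "diff_chain x xs" "fst x \<in> colors"
  shows "mset (nonzero_parts xs) \<in> P_D"
proof -
  have "\<not> \<rho> \<subseteq># mset (nonzero_parts xs)" if "\<rho> \<in> D" for \<rho>
  proof
    assume sub: "\<rho> \<subseteq># mset (nonzero_parts xs)"
    from that consider
      \<alpha> \<beta> i where "\<rho> = {#(\<alpha>, i), (\<beta>, i)#}" "E \<alpha> \<beta> * E \<beta> \<alpha> \<ge> 1"
      | \<alpha> \<beta> i where "\<rho> = {#(\<alpha>, i - 1), (\<beta>, i)#}" "E \<alpha> \<beta> = 2"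
      unfolding D_def by blast
    \<comment> \<open>Two parts with the same index would need \<open>E \<alpha> \<beta> = 0\<close>
      or \<open>E \<beta> \<alpha> = 0\<close>. For consecutive indices only the order with
      \<open>i\<close> first is possible, and it needs
      \<open>E \<alpha> \<beta> \<le> 1\<close>.\<close>
    then show False
    proof cases
      case 1
      with sorted_wrt_pair[OF nonzero_parts_separated[OF assms], of "(\<alpha>, i)" "(\<beta>, i)"] sub
      show False by (auto simp: separated_def)
    next
      case 2
      with sorted_wrt_pair[OF nonzero_parts_separated[OF assms], of "(\<alpha>, i - 1)" "(\<beta>, i)"] sub
      show False by (auto simp: separated_def)
    qed
  qed
  then show ?thesis
    using nonzero_parts_subset[OF assms(1)] by (auto simp: P_D_def partitions_def)
qed

lemma part_key_mono:
  assumes "separated p q" "p \<in> parts" "q \<in> parts"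
  shows "part_key p \<le> part_key q"
proof (cases "snd p = snd q")
  case True
  with assms have "E (fst q) (fst p) = 0" by (simp add: separated_def)
  with True assms E_eq_0_imp_ge show ?thesis by (auto simp: part_key_def parts_def)
next
  case False
  with assms show ?thesis by (auto simp: part_key_def parts_def colors_def separated_def)
qed

lemma part_key_inj: "inj_on part_key parts"
proof (rule inj_onI)
  fix p q assume pq: "p \<in> parts" "q \<in> parts" "part_key p = part_key q"
  have "a = b \<and> x = y" if "10 * x + a = 10 * y + b" "a \<le> 9" "b \<le> 9" for a b x y :: nat
    using that by presburger
  from this[of "nat (- snd p)" "fst p" "nat (- snd q)" "fst q"] pq show "p = q"
    by (auto simp: part_key_def parts_def colors_def)
qed

lemma sorted_nonzero_parts:
  assumes "diff_chain x xs" "fst x \<in> colors"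
  shows "sorted (map part_key (nonzero_parts xs))"
  unfolding sorted_wrt_map
proof (rule sorted_wrt_mono_rel[OF _ nonzero_parts_separated[OF assms]])
  fix p q assume "p \<in> set (nonzero_parts xs)" "q \<in> set (nonzero_parts xs)" "separated p q"
  then show "part_key p \<le> part_key q"
    using part_key_mono nonzero_parts_subset[OF assms(1)] by blast
qed

text \<open>By column 4 of \<open>E\<close>, only \<open>(4, 0)\<close> can follow
  \<open>(4, 0)\<close> at level 0, and levels stay positive once they are positive.\<close>

lemma diff_chain_4_split:
  assumes "diff_chain (4, 0) xs"
  shows "xs = replicate (length xs - length (nonzero_parts xs)) (4, 0) @ map of_part (nonzero_parts xs)"
  using assms
proof (induction xs)
  case (Cons y ys)
  have le: "length (nonzero_parts ys) \<le> length ys"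
    by (simp add: nonzero_parts_def)
  show ?case
  proof (cases "snd y = 0")
    case True
    with Cons.prems have "y = (4, 0)"
      by (auto simp: prod_eq_iff E_4 split: if_splits)
    with Cons le show ?thesis
      by (simp add: nonzero_parts_def Suc_diff_le)
  next
    case False
    have "sorted_wrt (\<lambda>x y. separated (to_part x) (to_part y)) (y # ys)"
      using diff_chain_sorted[of y ys] Cons.prems by simp
    with False have "\<forall>z\<in>set (y # ys). snd z > 0"
      by (auto simp: separated_def to_part_def)
    then have "filter (\<lambda>x. snd x > 0) ys = ys" "snd y > 0"
      by (simp_all add: filter_id_conv)
    moreover have "of_part (to_part x) = x" for x
      by (simp add: of_part_def to_part_def)
    ultimately show ?thesis by (simp add: nonzero_parts_def comp_def)
  qed
qed (simp add: nonzero_parts_def)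

text \<open>The injective key makes the sorted list of parts unique; the fixed length
  \<open>L\<close> then determines the amount of padding.\<close>

lemma nonzero_parts_inj:
  "inj_on (\<lambda>xs. mset (nonzero_parts xs)) (diff_chains L 4)"
proof (rule inj_onI)
  fix xs ys
  assume xs: "xs \<in> diff_chains L 4" and ys: "ys \<in> diff_chains L 4"
    and eq: "mset (nonzero_parts xs) = mset (nonzero_parts ys)"
  then have c: "diff_chain (4, 0) xs" "diff_chain (4, 0) ys" "length xs = length ys"
    by (auto simp: diff_chains_def)
  have 4: "fst (4, 0) \<in> colors" by (simp add: colors_def)
  have "mset (map part_key (nonzero_parts xs)) = mset (map part_key (nonzero_parts ys))"
    using eq by simp
  then have "map part_key (nonzero_parts xs) = map part_key (nonzero_parts ys)"
    using properties_for_sort sorted_nonzero_parts[OF c(1) 4] sorted_nonzero_parts[OF c(2) 4] by metis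
  then have "nonzero_parts xs = nonzero_parts ys"
    by (rule map_inj_on) (rule inj_on_subset[OF part_key_inj],
        use nonzero_parts_subset[OF c(1)] nonzero_parts_subset[OF c(2)] in blast)
  with diff_chain_4_split[OF c(1)] diff_chain_4_split[OF c(2)] c(3) show "xs = ys" by metis
qed

lemma part_degree_to_part:
  assumes "fst x \<in> colors" "snd x > 0"
  shows "part_degree (to_part x) = deg x"
  using assms unfolding colors_eq by (auto simp: part_degree_def to_part_def deg_def offset_def Let_def)

lemma part_degree_eq_deg:
  assumes "p \<in> parts"
  shows "part_degree p = deg (of_part p)"
proof -
  have "to_part (of_part p) = p" "fst (of_part p) \<in> colors" "snd (of_part p) > 0"
    using assms by (auto simp: to_part_def of_part_def parts_def)
  then show ?thesis using part_degree_to_part[of "of_part p"] by simp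
qed

lemma weight_nonzero_parts:
  assumes "diff_chain (4, 0) xs"
  shows "partition_degree (mset (nonzero_parts xs)) = weight xs"
proof -
  have "deg (4, 0) = 0" by (simp add: deg_def offset_def)
  then have "weight xs = sum_list (map deg (map of_part (nonzero_parts xs)))"
    by (subst diff_chain_4_split[OF assms]) (simp add: sum_list_replicate)
  also have "map deg (map of_part (nonzero_parts xs)) = map part_degree (nonzero_parts xs)"
    using nonzero_parts_subset[OF assms] by (auto simp: part_degree_eq_deg)
  finally show ?thesis
    by (simp add: partition_degree_def flip: sum_mset_sum_list)
qed

section \<open>From partitions back to chains\<close>

text \<open>Only neighbours need checking: equal and consecutive levels are governed by
  \<open>D\<close>, and larger gaps suffice because the entries of \<open>E\<close> are at most
  2.\<close>

lemma sorted_imp_diff_chain: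
  assumes "set (p # ps) \<subseteq> parts" "sorted (map part_key (p # ps))" "\<not> (\<exists>\<rho>\<in>D. \<rho> \<subseteq># mset (p # ps))"
  shows "diff_chain (of_part p) (map of_part ps)"
  using assms
proof (induction ps arbitrary: p)
  case (Cons r ps)
  obtain \<alpha> i \<beta> j where p: "p = (\<alpha>, i)" and r: "r = (\<beta>, j)" by fastforce
  have c: "\<alpha> \<in> colors" "\<beta> \<in> colors" "i < 0" "j < 0"
    using Cons.prems by (auto simp: p r parts_def)
  have key: "10 * nat (- i) + \<alpha> \<le> 10 * nat (- j) + \<beta>"
    using Cons.prems by (simp add: p r part_key_def)
  have notD: "{#p, r#} \<notin> D"
  proof
    assume "{#p, r#} \<in> D"
    moreover have "{#p, r#} \<subseteq># mset (p # r # ps)" by simp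
    ultimately show False using Cons.prems(3) by blast
  qed
  have "nat (- i) + E \<beta> \<alpha> \<le> nat (- j)"
  proof -
    consider "j = i" | "j = i - 1" | "j < i - 1" | "j > i" by linarith
    then show ?thesis
    proof cases
      case 1
      with key have "\<alpha> \<le> \<beta>" by simp
      moreover have "E \<alpha> \<beta> * E \<beta> \<alpha> = 0"
        using notD 1 c unfolding D_def p r by (auto simp: not_less_eq_eq)
      \<comment> \<open>If it is \<open>E \<alpha> \<beta>\<close> that vanishes, then
        \<open>\<beta> \<le> \<alpha>\<close>, and the sorting makes the colours equal.\<close>
      ultimately have "E \<beta> \<alpha> = 0"
        using E_eq_0_imp_ge[OF c(1,2)] by (cases "\<alpha> = \<beta>") auto
      with 1 show ?thesis by simp
    next
      case 2
      have "E \<beta> \<alpha> \<noteq> 2"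
      proof
        assume "E \<beta> \<alpha> = 2"
        with c have "{#(\<beta>, i - 1), (\<alpha>, i)#} \<in> D" unfolding D_def by blast
        with notD 2 show False by (simp add: p r add_mset_commute)
      qed
      with E_le_2[OF c(2,1)] 2 c show ?thesis by simp
    next
      case 3
      with E_le_2[OF c(2,1)] c show ?thesis by simp
    next
      case 4
      with key c show ?thesis by (auto simp: colors_def)
    qed
  qed
  moreover have "diff_chain (of_part r) (map of_part ps)"
  proof (rule Cons.IH)
    have "mset (r # ps) \<subseteq># mset (p # r # ps)" by simp
    with Cons.prems(3) show "\<not> (\<exists>\<rho>\<in>D. \<rho> \<subseteq># mset (r # ps))"
      by (blast dest: subset_mset.order_trans)
  qed (use Cons.prems in auto)
  ultimately show ?case
    using c by (simp add: p r of_part_def[of "(\<alpha>, i)"] of_part_def[of "(\<beta>, j)"])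
qed simp

lemma diff_chain_4_replicate: "diff_chain (4, 0) (replicate k (4, 0) @ xs) \<longleftrightarrow> diff_chain (4, 0) xs"
  by (induction k) (simp_all add: E_4 colors_def)

lemma size_le_partition_degree:
  assumes "set_mset \<pi> \<subseteq> parts"
  shows "size \<pi> \<le> partition_degree \<pi>"
proof -
  have "1 \<le> part_degree p" if "p \<in> parts" for p
    using that by (auto simp: parts_def part_degree_def Let_def)
  then have "(\<Sum>p\<in>#\<pi>. 1) \<le> (\<Sum>p\<in>#\<pi>. part_degree p)"
    using assms by (intro sum_mset_mono) blast
  then show ?thesis by (simp add: partition_degree_def)
qed

text \<open>Sort by \<open>part_key\<close> and pad in front with \<open>(4, 0)\<close>. Length
  \<open>L\<close> suffices because every part has degree at least 1; the first proper part may
  follow the padding because column 4 of \<open>E\<close> has entries at most 1.\<close>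

lemma P_D_eq_nonzero_parts:
  assumes "\<pi> \<in> P_D" "partition_degree \<pi> \<le> L"
  obtains xs where "xs \<in> diff_chains L 4" "mset (nonzero_parts xs) = \<pi>"
proof -
  have sub: "set_mset \<pi> \<subseteq> parts" and nD: "\<not> (\<exists>\<rho>\<in>D. \<rho> \<subseteq># \<pi>)"
    using assms by (auto simp: P_D_def partitions_def)
  obtain zs where zs: "mset zs = \<pi>" using ex_mset by blast
  define ps where "ps = sort_key part_key zs"
  have ps: "mset ps = \<pi>" "sorted (map part_key ps)" "set ps \<subseteq> parts"
    using zs sub by (auto simp: ps_def)
  have len: "length ps \<le> L"
    using size_le_partition_degree[OF sub] assms(2) ps(1) by auto
  have "diff_chain (4, 0) (map of_part ps)"
  proof (cases ps)
    case (Cons p ps')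
    have "diff_chain (of_part p) (map of_part ps')"
      using sorted_imp_diff_chain[of p ps'] ps nD Cons by simp
    then show ?thesis
      using ps(3) by (auto simp: Cons E_4 of_part_def parts_def)
  qed simp
  then have "replicate (L - length ps) (4, 0) @ map of_part ps \<in> diff_chains L 4"
    using len by (simp add: diff_chains_def diff_chain_4_replicate)
  moreover have "nonzero_parts (replicate (L - length ps) (4, 0) @ map of_part ps) = ps"
  proof -
    have "filter (\<lambda>x. snd x > 0) (map of_part ps) = map of_part ps"
      using ps(3) by (auto simp: filter_id_conv of_part_def parts_def)
    moreover have "map to_part (map of_part ps) = map id ps"
      unfolding map_map by (rule map_cong) (use ps(3) in \<open>auto simp: of_part_def to_part_def parts_def\<close>)
    ultimately show ?thesis by (simp add: nonzero_parts_def)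
  qed
  ultimately show ?thesis using that ps(1) by metis
qed

section \<open>Counting partitions and the infinite product\<close>

lemma card_P_D_degree:
  assumes "n \<le> L"
  shows "card {\<pi> \<in> P_D. partition_degree \<pi> = n} = card {xs \<in> diff_chains L 4. weight xs = n}"
proof -
  let ?f = "\<lambda>xs. mset (nonzero_parts xs)"
  have "?f ` {xs \<in> diff_chains L 4. weight xs = n} = {\<pi> \<in> P_D. partition_degree \<pi> = n}"
  proof (intro equalityI subsetI)
    fix \<pi> assume "\<pi> \<in> ?f ` {xs \<in> diff_chains L 4. weight xs = n}"
    then show "\<pi> \<in> {\<pi> \<in> P_D. partition_degree \<pi> = n}"
      using nonzero_parts_in_P_D[of "(4, 0)"] weight_nonzero_parts
      by (auto simp: diff_chains_def colors_def)
  next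
    fix \<pi> assume \<pi>: "\<pi> \<in> {\<pi> \<in> P_D. partition_degree \<pi> = n}"
    then obtain xs where xs: "xs \<in> diff_chains L 4" "?f xs = \<pi>"
      using P_D_eq_nonzero_parts[of \<pi> L] assms by blast
    with \<pi> weight_nonzero_parts[of xs] have "weight xs = n" by (simp add: diff_chains_def)
    with xs show "\<pi> \<in> ?f ` {xs \<in> diff_chains L 4. weight xs = n}" by blast
  qed
  moreover
  have "inj_on ?f {xs \<in> diff_chains L 4. weight xs = n}"
    by (rule inj_on_subset[OF nonzero_parts_inj]) blast
  then have "card (?f ` {xs \<in> diff_chains L 4. weight xs = n}) = card {xs \<in> diff_chains L 4. weight xs = n}"
    by (rule card_image)
  ultimately show ?thesis by (simp only:)
qed

lemma card_P_D_degree_eq: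
  assumes "n \<le> L"
  shows "of_nat (card {\<pi> \<in> P_D. partition_degree \<pi> = n}) = (fps_nth (inv_qpoch L) n :: 'a::field)"
proof -
  have "of_nat (card {\<pi> \<in> P_D. partition_degree \<pi> = n}) = fps_nth (gf weight (diff_chains L 4) :: 'a fps) n"
    by (simp add: gf_nth card_P_D_degree[OF assms])
  also have "\<dots> = fps_nth (inv_qpoch L) n"
    using durfee_sum_3_nth[OF assms] by (simp add: gf_diff_chains colors_def closed_form_def)
  finally show ?thesis .
qed

theorem theorem2p1:
  shows "(\<lambda>r. inverse (1 - fps_X ^ Suc r) :: rat fps) has_prod
           Abs_fps (\<lambda>n. of_nat (card {\<pi> \<in> P_D. partition_degree \<pi> = n}))"
proof -
  let ?F = "Abs_fps (\<lambda>n. of_nat (card {\<pi> \<in> P_D. partition_degree \<pi> = n})) :: rat fps"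
  have partial: "(\<Prod>i\<le>n. inverse (1 - fps_X ^ Suc i)) = (inv_qpoch (Suc n) :: rat fps)" for n
    by (simp add: inv_qpoch_def lessThan_Suc_atMost)
  have "(\<lambda>n. \<Prod>i\<le>n. inverse (1 - fps_X ^ Suc i)) \<longlonglongrightarrow> ?F"
    unfolding partial
  proof (rule tendsto_fpsI)
    fix m
    have "fps_nth (inv_qpoch (Suc n)) m = fps_nth ?F m" if "n \<ge> m" for n
      using card_P_D_degree_eq[of m "Suc n", where 'a=rat] that by simp
    then show "\<forall>\<^sub>F n in sequentially. fps_nth (inv_qpoch (Suc n)) m = fps_nth ?F m"
      unfolding eventually_sequentially by blast
  qed
  \<comment> \<open>\<open>has_prod\<close> demands a nonzero limit here; the constant coefficient
    is 1.\<close>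
  moreover have "?F \<noteq> 0"
  proof
    assume "?F = 0"
    then have "fps_nth ?F 0 = 0" by (simp only: fps_zero_nth)
    then show False
      using card_P_D_degree_eq[of 0 0, where 'a=rat] by simp
  qed
  ultimately show ?thesis
    unfolding has_prod_def raw_has_prod_def add_0_right by blast
qed

end
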